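(* (Completeness of access Hoare logic.) For every program $C$ of the while language and all assertions $P,Q$: if $\langle P\rangle\,C\,\langle Q\rangle$ is valid, then $\langle P\rangle\,C\,\langle Q\rangle$ is provable in access Hoare logic.
   Context: States are mappings from variables to values; assertions are arbitrary predicates on states. Programs of the while language are built from $\mathtt{skip}$, assignments $V:=E$ ($V$ a variable, $E$ a side-effect-free expression possibly containing $V$), sequential composition $S;T$, $\mathtt{if}\ B\ \mathtt{then}\ S\ \mathtt{else}\ T$ and $\mathtt{while}\ B\ \mathtt{do}\ S$ ($B$ a boolean condition), with the standard deterministic big-step execution relation $C:s\Rightarrow s'$. The access Hoare triple $\langle P\rangle\,C\,\langle Q\rangle$ is valid iff $\forall s,s'\,[\,C:s\Rightarrow s'\wedge Q(s')\rightarrow P(s)\,]$. Access Hoare logic is the calculus with the following axioms and rules: (skip) $\langle P\rangle\,\mathtt{skip}\,\langle P\rangle$; (assignment) $\langle P[E/V]\rangle\,V:=E\,\langle P\rangle$, where $P[E/V]$ replaces free occurrences of $V$ in $P$ by $E$; (consequence) from $P_2\rightarrow P_1$ (valid implication), $\langle P_2\rangle\,S\,\langle Q_2\rangle$ and $Q_1\rightarrow Q_2$ (valid implication) infer $\langle P_1\rangle\,S\,\langle Q_1\rangle$; (composition) from $\langle P\rangle\,S\,\langle R\rangle$ and $\langle R\rangle\,T\,\langle Q\rangle$ infer $\langle P\rangle\,S;T\,\langle Q\rangle$; (conditional) from $\langle B\rightarrow P\rangle\,S\,\langle Q\rangle$ and $\langle \neg B\rightarrow P\rangle\,T\,\langle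 Q\rangle$ infer $\langle P\rangle\,\mathtt{if}\ B\ \mathtt{then}\ S\ \mathtt{else}\ T\,\langle Q\rangle$; (while) from $\langle B\rightarrow P\rangle\,S\,\langle P\rangle$ infer $\langle P\rangle\,\mathtt{while}\ B\ \mathtt{do}\ S\,\langle \neg B\rightarrow P\rangle$. *)

theory Defs
  imports Main
begin

type_synonym ('x, 'v) state = "'x \<Rightarrow> 'v"
type_synonym ('x, 'v) assn = "('x, 'v) state \<Rightarrow> bool"

text \<open>Expressions and boolean conditions are represented by their denotations, so programs
  range over every choice of side-effect-free expression language.\<close>

datatype ('x, 'v) com =
    Skip
  | Assign 'x "('x, 'v) state \<Rightarrow> 'v"
  | Seq "('x, 'v) com" "('x, 'v) com"
  | Cond "('x, 'v) state \<Rightarrow> bool" "('x, 'v) com" "('x, 'v) com"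
  | While "('x, 'v) state \<Rightarrow> bool" "('x, 'v) com"

inductive exec :: "('x, 'v) com \<Rightarrow> ('x, 'v) state \<Rightarrow> ('x, 'v) state \<Rightarrow> bool" where
  exec_Skip: "exec Skip s s"
| exec_Assign: "exec (Assign V E) s (s(V := E s))"
| exec_Seq: "exec S s s' \<Longrightarrow> exec T s' s'' \<Longrightarrow> exec (Seq S T) s s''"
| exec_CondTrue: "B s \<Longrightarrow> exec S s s' \<Longrightarrow> exec (Cond B S T) s s'"
| exec_CondFalse: "\<not> B s \<Longrightarrow> exec T s s' \<Longrightarrow> exec (Cond B S T) s s'"
| exec_WhileFalse: "\<not> B s \<Longrightarrow> exec (While B S) s s"
| exec_WhileTrue:
    "B s \<Longrightarrow> exec S s s' \<Longrightarrow> exec (While B S) s' s'' \<Longrightarrow> exec (While B S) s s''"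

definition access_valid :: "('x, 'v) assn \<Rightarrow> ('x, 'v) com \<Rightarrow> ('x, 'v) assn \<Rightarrow> bool" where
  "access_valid P C Q \<longleftrightarrow> (\<forall>s s'. exec C s s' \<and> Q s' \<longrightarrow> P s)"

text \<open>On assertions as predicates, substituting \<open>E\<close> for \<open>V\<close> amounts to evaluating in the
  updated state.\<close>

definition subst_assn :: "('x, 'v) assn \<Rightarrow> (('x, 'v) state \<Rightarrow> 'v) \<Rightarrow> 'x \<Rightarrow> ('x, 'v) assn" where
  "subst_assn P E V = (\<lambda>s. P (s(V := E s)))"

inductive access_provable ::
    "('x, 'v) assn \<Rightarrow> ('x, 'v) com \<Rightarrow> ('x, 'v) assn \<Rightarrow> bool" where
  ah_Skip: "access_provable P Skip P"
| ah_Assign: "access_provable (subst_assn P E V) (Assign V E) P"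
| ah_Conseq:
    "(\<forall>s. P2 s \<longrightarrow> P1 s) \<Longrightarrow> access_provable P2 S Q2 \<Longrightarrow> (\<forall>s. Q1 s \<longrightarrow> Q2 s) \<Longrightarrow>
     access_provable P1 S Q1"
| ah_Seq:
    "access_provable P S R \<Longrightarrow> access_provable R T Q \<Longrightarrow> access_provable P (Seq S T) Q"
| ah_Cond:
    "access_provable (\<lambda>s. B s \<longrightarrow> P s) S Q \<Longrightarrow> access_provable (\<lambda>s. \<not> B s \<longrightarrow> P s) T Q \<Longrightarrow>
     access_provable P (Cond B S T) Q"
| ah_While:
    "access_provable (\<lambda>s. B s \<longrightarrow> P s) S P \<Longrightarrow>
     access_provable P (While B S) (\<lambda>s. \<not> B s \<longrightarrow> P s)"

end

theory Submission
  imports Defs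
begin

text \<open>As for ordinary Hoare logic, one inducts on the program, using as intermediate assertion
  the set of states from which execution can reach \<open>Q\<close>. For a loop, this set is an invariant.\<close>

definition wpp :: "('x, 'v) com \<Rightarrow> ('x, 'v) assn \<Rightarrow> ('x, 'v) assn" where
  "wpp C Q = (\<lambda>s. \<exists>s'. exec C s s' \<and> Q s')"

text \<open>Thus \<open>wpp C Q\<close> is the strongest valid precondition for \<open>Q\<close>;
  the implication runs opposite to that for the weakest liberal precondition of ordinary Hoare
  logic.\<close>

lemma access_valid_iff_wpp: "access_valid P C Q \<longleftrightarrow> (\<forall>s. wpp C Q s \<longrightarrow> P s)"
  by (auto simp: access_valid_def wpp_def)

lemma access_valid_SeqD: "access_valid P (Seq S T) Q \<Longrightarrow> access_valid P S (wpp T Q)"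
  by (auto simp: access_valid_def wpp_def intro: exec_Seq)

lemma access_valid_CondD:
  assumes "access_valid P (Cond B S T) Q"
  shows "access_valid (\<lambda>s. B s \<longrightarrow> P s) S Q" and "access_valid (\<lambda>s. \<not> B s \<longrightarrow> P s) T Q"
  using assms by (auto simp: access_valid_def intro: exec_CondTrue exec_CondFalse)

text \<open>Where \<open>B\<close> holds, a run of \<open>S\<close> followed by a run of the loop
  that ends in \<open>Q\<close> is itself a run of the loop; where \<open>B\<close> fails, the
  precondition is vacuously true.\<close>

lemma access_valid_wpp_While:
  "access_valid (\<lambda>s. B s \<longrightarrow> wpp (While B S) Q s) S (wpp (While B S) Q)"
  by (auto simp: access_valid_def wpp_def intro: exec_WhileTrue)

theorem theorem6p2:
  fixes C :: "('x, 'v) com" and P Q :: "('x, 'v) assn"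
  assumes "access_valid P C Q"
  shows "access_provable P C Q"
  using assms
proof (induction C arbitrary: P Q)
  case Skip
  then have "\<forall>s. Q s \<longrightarrow> P s"
    by (auto simp: access_valid_def intro: exec_Skip)
  then show ?case
    by (rule ah_Conseq[OF _ ah_Skip]) simp
next
  case (Assign V E)
  then have "\<forall>s. subst_assn Q E V s \<longrightarrow> P s"
    by (auto simp: access_valid_def subst_assn_def intro: exec_Assign)
  then show ?case
    by (rule ah_Conseq[OF _ ah_Assign]) simp
next
  case (Seq S T)
  have "access_provable P S (wpp T Q)"
    by (intro Seq.IH(1) access_valid_SeqD Seq.prems)
  \<comment> \<open>This triple is valid because \<open>wpp T Q\<close> trivially implies
    itself.\<close>
  moreover have "access_provable (wpp T Q) T Q"
    by (intro Seq.IH(2)) (simp add: access_valid_iff_wpp)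
  ultimately show ?case
    by (rule ah_Seq)
next
  case (Cond B S T)
  show ?case
    by (intro ah_Cond Cond.IH access_valid_CondD[OF Cond.prems])
next
  case (While B S)
  let ?W = "wpp (While B S) Q"
  have "access_provable ?W (While B S) (\<lambda>s. \<not> B s \<longrightarrow> ?W s)"
    by (intro ah_While While.IH access_valid_wpp_While)
  moreover have "\<forall>s. ?W s \<longrightarrow> P s"
    using While.prems by (simp add: access_valid_iff_wpp)
  \<comment> \<open>If the guard already fails in a state satisfying \<open>Q\<close>, the loop
    stops there at once. So consequence may strengthen the postcondition given by the while rule to
    \<open>Q\<close>.\<close>
  moreover have "\<forall>s. Q s \<longrightarrow> \<not> B s \<longrightarrow> ?W s"
    by (auto simp: wpp_def intro: exec_WhileFalse)
  ultimately show ?case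
    by (intro ah_Conseq[of ?W P _ "\<lambda>s. \<not> B s \<longrightarrow> ?W s"])
qed

end
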